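(* Let $C$ be a convex subset of a linear metric space $(X,d)$ having the property that for each $x\in C$ with $x\neq 0$, the map $f_x:[0,1]\to\mathbb{R}$, where $f_x(t)=d(0,tx)$ for all $t\in[0,1]$, is strictly increasing. Then $C$ is a round subset of $X$ in the subspace topology.
   Context: A linear metric space is a topological vector space with a compatible translation invariant metric $d$. A subset $C$ of a linear metric space is convex if $x,y\in C$ implies $(1-t)x+ty\in C$ for all $t\in[0,1]$. For a metric space $(Y,d)$, $y\in Y$ and $r>0$, write $B_d(y,r)=\{z\in Y: d(y,z)<r\}$ and $B_d[y,r]=\{z\in Y: d(y,z)\le r\}$. The metric $d$ is a round metric for $Y$ if the closure of $B_d(y,r)$ in $Y$ equals $B_d[y,r]$ for all $y\in Y$ and $r>0$. A metric space is round if its topology is induced by a round metric; a subset of $X$ is round in the subspace topology if it is round as a space with the topology inherited from $X$. *)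

theory Defs
  imports "HOL-Analysis.Analysis"
begin

class topological_real_vector = real_vector + topological_group_add +
  assumes tendsto_scaleR_Pair:
    "LIM p (nhds a \<times>\<^sub>F nhds x). fst p *\<^sub>R snd p :> nhds (a *\<^sub>R x)"

(* Compatibility of the metric with the vector topology is part of the superclass
   metric_space, where the open sets are those generated by dist. *)
class linear_metric_space = topological_real_vector + metric_space +
  assumes dist_translation_invariant: "dist (x + z) (y + z) = dist x y"

(* Metric_space.mcball is the set {z. d y z \<le> r}, which need not be the closure of the open ball. *)
definition round_metric :: "'a set \<Rightarrow> ('a \<Rightarrow> 'a \<Rightarrow> real) \<Rightarrow> bool" where
  "round_metric Y d \<longleftrightarrow> Metric_space Y d \<and>
     (\<forall>y\<in>Y. \<forall>r>0. Metric_space.mtopology Y d closure_of Metric_space.mball Y d y r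
                 = Metric_space.mcball Y d y r)"

definition round_space :: "'a topology \<Rightarrow> bool" where
  "round_space T \<longleftrightarrow>
     (\<exists>d. round_metric (topspace T) d \<and> Metric_space.mtopology (topspace T) d = T)"

end

theory Submission
  imports Defs
begin

text \<open>
  Every linear metric space carries a compatible translation invariant metric that is strictly
  increasing along all rays from the origin (a theorem of Eidelheit and Mazur), and such a metric
  is round on every convex set: if \<open>z\<close> has distance exactly \<open>r\<close> from \<open>y\<close>, then the points
  \<open>y + t (z - y)\<close> with \<open>t < 1\<close> are strictly closer to \<open>y\<close>, lie in the convex set, and converge
  to \<open>z\<close> as \<open>t\<close> tends to \<open>1\<close>.

  The given metric \<open>d\<close> need not be round on \<open>C\<close>: the function \<open>t \<mapsto> d(0, t x)\<close> is strictly increasing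
  for \<open>x\<close> in \<open>C\<close>, whereas the argument above moves along differences \<open>z - y\<close>, which may lie outside
  \<open>C\<close>. For instance, the plane with \<open>d(0, (a, b)) = \<bar>a\<bar> + min 1 \<bar>b\<bar>\<close> and the segment
  \<open>C = {1} \<times> [0, 2]\<close> satisfy the assumptions, but \<open>d\<close> is truncated at \<open>1\<close> on \<open>C\<close>. This is why the
  metric is replaced. The new one is obtained in two steps.

  First, the supremum \<open>p x\<close> of \<open>min 1 (d(0, t x))\<close> over \<open>\<bar>t\<bar> \<le> 1\<close> is a bounded subadditive gauge
  that is weakly increasing along rays and has the same neighbourhoods of \<open>0\<close> as \<open>d\<close>; the latter
  holds because scalar multiplication is jointly continuous at the origin (\<open>tendsto_balanced_gauge\<close>).

  Second, \<open>N x\<close> is the sum of \<open>2\<^sup>-\<^sup>n p (s\<^sub>n x)\<close>, where \<open>s\<^sub>n\<close> runs through all rationals. If \<open>N\<close>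
  failed to increase strictly between \<open>a x\<close> and \<open>b x\<close> with \<open>0 \<le> a < b\<close>, then \<open>p (s a x) = p (s b x)\<close>
  for every rational \<open>s\<close>. For a rational \<open>u\<close> with \<open>a/b < u < 1\<close> this makes \<open>p (b u\<^sup>k x)\<close> nondecreasing
  in \<open>k\<close>, although its limit is \<open>0\<close>; so \<open>p (b x) = 0\<close> and \<open>x = 0\<close> (\<open>radial_gauge_strict_mono\<close>).
\<close>

section \<open>A bounded gauge that is monotone along rays\<close>

lemma tendsto_scaleR_topological:
  fixes x :: "'a::topological_real_vector"
  assumes "(f \<longlongrightarrow> a) F" and "(g \<longlongrightarrow> x) F"
  shows "((\<lambda>i. f i *\<^sub>R g i) \<longlongrightarrow> a *\<^sub>R x) F"
  using filterlim_compose[OF tendsto_scaleR_Pair filterlim_Pair[OF assms]] by simp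

lemma dist_0_add_le:
  fixes x y :: "'a::linear_metric_space"
  shows "dist 0 (x + y) \<le> dist 0 x + dist 0 y"
proof -
  have "dist x (x + y) = dist 0 y"
    using dist_translation_invariant[of 0 x y] by (simp add: add.commute)
  then show ?thesis
    using dist_triangle[of 0 "x + y" x] by simp
qed

lemma dist_eq_dist_0_diff:
  fixes x y :: "'a::linear_metric_space"
  shows "dist x y = dist 0 (x - y)"
  using dist_translation_invariant[of "x - y" y 0] by (simp add: dist_commute)

text \<open>Truncating at \<open>1\<close> makes the supremum finite and keeps subadditivity.\<close>
definition balanced_gauge :: "'a::linear_metric_space \<Rightarrow> real" where
  "balanced_gauge x = (SUP t\<in>{-1..1}. min 1 (dist 0 (t *\<^sub>R x)))"

lemma balanced_gauge_upper: "\<bar>t\<bar> \<le> 1 \<Longrightarrow> min 1 (dist 0 (t *\<^sub>R x)) \<le> balanced_gauge x"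
  unfolding balanced_gauge_def by (rule cSUP_upper) (auto intro: bdd_aboveI[of _ 1])

lemma balanced_gauge_least:
  "(\<And>t. \<bar>t\<bar> \<le> 1 \<Longrightarrow> min 1 (dist 0 (t *\<^sub>R x)) \<le> b) \<Longrightarrow> balanced_gauge x \<le> b"
  unfolding balanced_gauge_def by (rule cSUP_least) auto

lemma min_dist_le_balanced_gauge: "min 1 (dist 0 x) \<le> balanced_gauge x"
  using balanced_gauge_upper[of 1 x] by simp

lemma balanced_gauge_nonneg: "0 \<le> balanced_gauge x"
  using min_dist_le_balanced_gauge[of x] by (smt (verit) zero_le_dist)

lemma balanced_gauge_le_1: "balanced_gauge x \<le> 1"
  by (rule balanced_gauge_least) simp

lemma abs_balanced_gauge [simp]: "\<bar>balanced_gauge x\<bar> = balanced_gauge x"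
  by (rule abs_of_nonneg) (rule balanced_gauge_nonneg)

lemma balanced_gauge_eq_0_iff: "balanced_gauge x = 0 \<longleftrightarrow> x = 0"
proof
  assume "balanced_gauge x = 0"
  then show "x = 0"
    using min_dist_le_balanced_gauge[of x] by (auto simp: min_def split: if_splits)
next
  assume "x = 0"
  then have "balanced_gauge x \<le> 0"
    by (intro balanced_gauge_least) simp
  then show "balanced_gauge x = 0"
    using balanced_gauge_nonneg[of x] by simp
qed

lemma balanced_gauge_add: "balanced_gauge (x + y) \<le> balanced_gauge x + balanced_gauge y"
proof (rule balanced_gauge_least)
  fix t :: real
  assume t: "\<bar>t\<bar> \<le> 1"
  have "dist 0 (t *\<^sub>R (x + y)) \<le> dist 0 (t *\<^sub>R x) + dist 0 (t *\<^sub>R y)"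
    using dist_0_add_le[of "t *\<^sub>R x" "t *\<^sub>R y"] by (simp add: scaleR_add_right)
  then have "min 1 (dist 0 (t *\<^sub>R (x + y))) \<le> min 1 (dist 0 (t *\<^sub>R x)) + min 1 (dist 0 (t *\<^sub>R y))"
    by (smt (verit) zero_le_dist)
  then show "min 1 (dist 0 (t *\<^sub>R (x + y))) \<le> balanced_gauge x + balanced_gauge y"
    using balanced_gauge_upper[OF t, of x] balanced_gauge_upper[OF t, of y] by linarith
qed

lemma balanced_gauge_scaleR_le:
  assumes "\<bar>c\<bar> \<le> 1"
  shows "balanced_gauge (c *\<^sub>R x) \<le> balanced_gauge x"
proof (rule balanced_gauge_least)
  fix t :: real
  assume "\<bar>t\<bar> \<le> 1"
  with assms have "\<bar>t * c\<bar> \<le> 1"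
    by (simp add: abs_mult mult_le_one)
  then show "min 1 (dist 0 (t *\<^sub>R c *\<^sub>R x)) \<le> balanced_gauge x"
    using balanced_gauge_upper[of "t * c" x] by simp
qed

lemma balanced_gauge_scaleR_mono:
  assumes "\<bar>a\<bar> \<le> \<bar>b\<bar>"
  shows "balanced_gauge (a *\<^sub>R x) \<le> balanced_gauge (b *\<^sub>R x)"
proof (cases "b = 0")
  case True
  then show ?thesis
    using assms by simp
next
  case False
  then have "\<bar>a / b\<bar> \<le> 1" and "a *\<^sub>R x = (a / b) *\<^sub>R b *\<^sub>R x"
    using assms by (auto simp: divide_le_eq)
  then show ?thesis
    by (metis balanced_gauge_scaleR_le)
qed

text \<open>
  Joint continuity of scalar multiplication at the origin bounds \<open>dist 0 (s u)\<close> for all \<open>s\<close> below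
  some \<open>\<delta>\<close> simultaneously, and rescaling by \<open>\<delta>\<close> turns this into a bound on the whole supremum.
\<close>
lemma tendsto_balanced_gauge: "(balanced_gauge \<longlongrightarrow> 0) (nhds (0::'a::linear_metric_space))"
proof (rule order_tendstoI)
  fix e :: real
  assume "0 < e"
  have "((\<lambda>p. fst p *\<^sub>R snd p) \<longlongrightarrow> (0::'a)) (nhds (0::real) \<times>\<^sub>F nhds (0::'a))"
    using tendsto_scaleR_Pair[of 0 "0::'a"] by simp
  then have "\<forall>\<^sub>F p in nhds (0::real) \<times>\<^sub>F nhds (0::'a). dist (fst p *\<^sub>R snd p) 0 < e / 2"
    by (rule tendstoD) (use \<open>0 < e\<close> in simp)
  then obtain P Q where P: "\<forall>\<^sub>F s in nhds (0::real). P s" and Q: "\<forall>\<^sub>F u in nhds (0::'a). Q u"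
    and PQ: "\<And>s u. P s \<Longrightarrow> Q u \<Longrightarrow> dist (s *\<^sub>R u) 0 < e / 2"
    unfolding eventually_prod_filter by auto
  from P obtain \<delta> where "\<delta> > 0" and \<delta>: "\<And>s. \<bar>s\<bar> < \<delta> \<Longrightarrow> P s"
    unfolding eventually_nhds_metric by (auto simp: dist_real_def)
  have "((\<lambda>x. (2 / \<delta>) *\<^sub>R x) \<longlongrightarrow> (2 / \<delta>) *\<^sub>R (0::'a)) (nhds 0)"
    by (intro tendsto_scaleR_topological tendsto_const filterlim_ident)
  then have "\<forall>\<^sub>F x in nhds 0. Q ((2 / \<delta>) *\<^sub>R x)"
    using Q by (auto simp: filterlim_iff)
  then show "\<forall>\<^sub>F x in nhds (0::'a). balanced_gauge x < e"
  proof eventually_elim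
    case (elim x)
    have "balanced_gauge x \<le> e / 2"
    proof (rule balanced_gauge_least)
      fix t :: real
      assume "\<bar>t\<bar> \<le> 1"
      then have "\<bar>t * (\<delta> / 2)\<bar> < \<delta>"
        using \<open>\<delta> > 0\<close> mult_right_mono[of "\<bar>t\<bar>" 1 \<delta>] by (simp add: abs_mult)
      from PQ[OF \<delta>[OF this] elim] have "dist 0 (t *\<^sub>R x) < e / 2"
        using \<open>\<delta> > 0\<close> by (simp add: dist_commute)
      then show "min 1 (dist 0 (t *\<^sub>R x)) \<le> e / 2"
        by simp
    qed
    then show ?case
      using \<open>0 < e\<close> by simp
  qed
qed (auto intro!: always_eventually intro: less_le_trans[OF _ balanced_gauge_nonneg])

section \<open>A gauge that is strictly increasing along rays\<close>

text \<open>
  The rationals serve as scalars because they are countable, dense, closed under powers and contain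
  \<open>1\<close>: density and powers yield strict growth, and \<open>1\<close> yields the comparison with \<open>dist\<close>.
\<close>
definition radial_gauge :: "'a::linear_metric_space \<Rightarrow> real" where
  "radial_gauge x = (\<Sum>n. (1/2) ^ n * balanced_gauge (of_rat (from_nat n) *\<^sub>R x))"

lemma summable_radial_gauge:
  "summable (\<lambda>n. (1/2) ^ n * balanced_gauge (of_rat (from_nat n) *\<^sub>R x))"
proof (rule summable_comparison_test')
  show "summable (\<lambda>n. (1/2::real) ^ n)"
    by (rule summable_geometric) simp
  show "norm ((1/2) ^ n * balanced_gauge (of_rat (from_nat n) *\<^sub>R x)) \<le> (1/2) ^ n" for n
    by (simp add: abs_mult mult_left_le balanced_gauge_le_1)
qed

lemma radial_gauge_term_le:
  "(1/2) ^ n * balanced_gauge (of_rat (from_nat n) *\<^sub>R x) \<le> radial_gauge x"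
  unfolding radial_gauge_def
  using sum_le_suminf[OF summable_radial_gauge, of "{n}" x] by (simp add: balanced_gauge_nonneg)

lemma radial_gauge_nonneg: "0 \<le> radial_gauge x"
  unfolding radial_gauge_def
  by (intro suminf_nonneg summable_radial_gauge mult_nonneg_nonneg balanced_gauge_nonneg) simp

lemma radial_gauge_lower:
  obtains c :: real where "0 < c" and "\<And>x::'a::linear_metric_space. c * min 1 (dist 0 x) \<le> radial_gauge x"
proof
  let ?n = "to_nat (1::rat)"
  show "0 < (1/2::real) ^ ?n"
    by simp
  show "(1/2) ^ ?n * min 1 (dist 0 x) \<le> radial_gauge x" for x :: 'a
  proof -
    have "(1/2) ^ ?n * min 1 (dist 0 x) \<le> (1/2) ^ ?n * balanced_gauge x"
      by (intro mult_left_mono min_dist_le_balanced_gauge) simp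
    also have "\<dots> \<le> radial_gauge x"
      using radial_gauge_term_le[of ?n x] by simp
    finally show ?thesis .
  qed
qed

lemma radial_gauge_0 [simp]: "radial_gauge 0 = 0"
  by (simp add: radial_gauge_def balanced_gauge_eq_0_iff[THEN iffD2])

lemma radial_gauge_eq_0_iff: "radial_gauge x = 0 \<longleftrightarrow> x = 0"
proof
  assume "radial_gauge x = 0"
  then show "x = 0"
    using radial_gauge_lower[where 'a='a]
    by (metis dist_nz less_numeral_extra(1) linorder_not_le min_less_iff_conj mult_pos_pos)
qed simp

lemma radial_gauge_minus: "radial_gauge (- x) = radial_gauge x"
proof -
  have "balanced_gauge (c *\<^sub>R (- x)) = balanced_gauge (c *\<^sub>R x)" for c
    using balanced_gauge_scaleR_mono[of c "- c" x] balanced_gauge_scaleR_mono[of "- c" c x] by simp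
  then show ?thesis
    by (simp only: radial_gauge_def)
qed

lemma radial_gauge_add: "radial_gauge (x + y) \<le> radial_gauge x + radial_gauge y"
  unfolding radial_gauge_def suminf_add[OF summable_radial_gauge summable_radial_gauge]
proof (rule suminf_le)
  fix n
  show "(1/2) ^ n * balanced_gauge (of_rat (from_nat n) *\<^sub>R (x + y))
    \<le> (1/2) ^ n * balanced_gauge (of_rat (from_nat n) *\<^sub>R x)
      + (1/2) ^ n * balanced_gauge (of_rat (from_nat n) *\<^sub>R y)"
    unfolding distrib_left[symmetric] scaleR_add_right
    by (intro mult_left_mono balanced_gauge_add) simp
qed (intro summable_radial_gauge summable_add)+

text \<open>Each summand is continuous at \<open>0\<close>, and the truncation gives a summable majorant.\<close>
lemma tendsto_radial_gauge: "(radial_gauge \<longlongrightarrow> 0) (nhds (0::'a::linear_metric_space))"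
proof -
  have "((\<lambda>x. \<Sum>n. (1/2) ^ n * balanced_gauge (of_rat (from_nat n) *\<^sub>R x)) \<longlongrightarrow> (\<Sum>n. 0)) (nhds (0::'a))"
  proof (rule tannerys_theorem[THEN conjunct2, THEN conjunct2])
    fix n
    have "((\<lambda>x. of_rat (from_nat n) *\<^sub>R x) \<longlongrightarrow> of_rat (from_nat n) *\<^sub>R (0::'a)) (nhds 0)"
      by (intro tendsto_scaleR_topological tendsto_const filterlim_ident)
    then have "((\<lambda>x. balanced_gauge (of_rat (from_nat n) *\<^sub>R x)) \<longlongrightarrow> 0) (nhds (0::'a))"
      using filterlim_compose[OF tendsto_balanced_gauge] by simp
    then show "((\<lambda>x. (1/2) ^ n * balanced_gauge (of_rat (from_nat n) *\<^sub>R x)) \<longlongrightarrow> 0) (nhds (0::'a))"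
      by (rule tendsto_mult_right_zero)
  next
    show "summable (\<lambda>n. (1/2::real) ^ n)"
      by (rule summable_geometric) simp
    show "\<forall>\<^sub>F (n, x) in at_top \<times>\<^sub>F nhds (0::'a).
        norm ((1/2) ^ n * balanced_gauge (of_rat (from_nat n) *\<^sub>R x)) \<le> (1/2) ^ n"
      by (auto intro!: always_eventually simp: abs_mult mult_left_le balanced_gauge_le_1)
    show "nhds (0::'a) \<noteq> bot"
      by simp
  qed
  then show ?thesis
    by (simp add: radial_gauge_def[abs_def])
qed

text \<open>
  Equality at \<open>a x\<close> and \<open>b x\<close> forces equality of all summands; iterating with the powers of a rational
  \<open>u\<close> between \<open>a / b\<close> and \<open>1\<close> then bounds the gauge of \<open>b x\<close> by its values at points tending to \<open>0\<close>.
\<close>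
lemma radial_gauge_strict_mono:
  fixes x :: "'a::linear_metric_space"
  assumes "0 \<le> a" and "a < b" and "x \<noteq> 0"
  shows "radial_gauge (a *\<^sub>R x) < radial_gauge (b *\<^sub>R x)"
proof (rule ccontr)
  assume contra: "\<not> ?thesis"
  have mono: "balanced_gauge (s *\<^sub>R a *\<^sub>R x) \<le> balanced_gauge (s *\<^sub>R b *\<^sub>R x)" for s
    using assms balanced_gauge_scaleR_mono[of "s * a" "s * b" x] by (simp add: abs_mult mult_left_mono)
  have eq: "balanced_gauge (of_rat q *\<^sub>R a *\<^sub>R x) = balanced_gauge (of_rat q *\<^sub>R b *\<^sub>R x)" for q
  proof (rule ccontr)
    assume "\<not> ?thesis"
    then have "balanced_gauge (of_rat q *\<^sub>R a *\<^sub>R x) < balanced_gauge (of_rat q *\<^sub>R b *\<^sub>R x)"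
      using mono[of "of_rat q"] by linarith
    then have less: "(1/2) ^ n * balanced_gauge (of_rat (from_nat n) *\<^sub>R a *\<^sub>R x)
        < (1/2) ^ n * balanced_gauge (of_rat (from_nat n) *\<^sub>R b *\<^sub>R x)" if "n = to_nat q" for n
      using that by simp
    have "0 < (\<Sum>n. (1/2) ^ n * balanced_gauge (of_rat (from_nat n) *\<^sub>R b *\<^sub>R x)
        - (1/2) ^ n * balanced_gauge (of_rat (from_nat n) *\<^sub>R a *\<^sub>R x))"
    proof (rule suminf_pos2[where i = "to_nat q"])
      show "0 \<le> (1/2) ^ n * balanced_gauge (of_rat (from_nat n) *\<^sub>R b *\<^sub>R x)
        - (1/2) ^ n * balanced_gauge (of_rat (from_nat n) *\<^sub>R a *\<^sub>R x)" for n
        using mono[of "of_rat (from_nat n)"] by (simp add: mult_left_mono)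
      show "0 < (1/2) ^ to_nat q * balanced_gauge (of_rat (from_nat (to_nat q)) *\<^sub>R b *\<^sub>R x)
        - (1/2) ^ to_nat q * balanced_gauge (of_rat (from_nat (to_nat q)) *\<^sub>R a *\<^sub>R x)"
        using less[OF refl] by (simp only: diff_gt_0_iff_gt)
    qed (intro summable_diff summable_radial_gauge)
    also have "\<dots> = radial_gauge (b *\<^sub>R x) - radial_gauge (a *\<^sub>R x)"
      unfolding radial_gauge_def by (rule suminf_diff[symmetric]) (rule summable_radial_gauge)+
    finally show False
      using contra by simp
  qed
  have "a / b < 1"
    using assms by simp
  then obtain u where "u \<in> \<rat>" and u: "a / b < u" "u < 1"
    using Rats_dense_in_real by blast
  then obtain q where q: "u = of_rat q"
    by (auto elim: Rats_cases)
  have "0 \<le> a / b"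
    using assms by simp
  then have "0 < u"
    using u by linarith
  have "a < u * b"
    using u assms by (simp add: divide_less_eq)
  have bound: "balanced_gauge (b *\<^sub>R x) \<le> balanced_gauge (u ^ k *\<^sub>R b *\<^sub>R x)" for k
  proof (induction k)
    case (Suc k)
    have "balanced_gauge (u ^ k *\<^sub>R b *\<^sub>R x) = balanced_gauge (u ^ k *\<^sub>R a *\<^sub>R x)"
      using eq[of "q ^ k"] by (simp add: q of_rat_power)
    also have "\<dots> \<le> balanced_gauge (u ^ Suc k *\<^sub>R b *\<^sub>R x)"
    proof -
      have "u ^ k * a \<le> u ^ k * (u * b)"
        using \<open>a < u * b\<close> \<open>0 < u\<close> by (intro mult_left_mono) auto
      then have "\<bar>u ^ k * a\<bar> \<le> \<bar>u ^ Suc k * b\<bar>"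
        using \<open>0 < u\<close> assms by (simp add: abs_mult mult_ac)
      then show ?thesis
        using balanced_gauge_scaleR_mono[of "u ^ k * a" "u ^ Suc k * b" x] by simp
    qed
    finally show ?case
      using Suc.IH by linarith
  qed simp
  have "(\<lambda>k. u ^ k *\<^sub>R b *\<^sub>R x) \<longlonglongrightarrow> 0 *\<^sub>R b *\<^sub>R x"
    using u \<open>0 < u\<close> by (intro tendsto_scaleR_topological LIMSEQ_power_zero tendsto_const) simp
  then have "(\<lambda>k. balanced_gauge (u ^ k *\<^sub>R b *\<^sub>R x)) \<longlonglongrightarrow> 0"
    using filterlim_compose[OF tendsto_balanced_gauge] by simp
  then have "balanced_gauge (b *\<^sub>R x) \<le> 0"
    by (rule Lim_bounded2) (use bound in auto)
  then have "b *\<^sub>R x = 0"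
    using balanced_gauge_nonneg[of "b *\<^sub>R x"] balanced_gauge_eq_0_iff[of "b *\<^sub>R x"] by simp
  then show False
    using assms by simp
qed

section \<open>Roundness of the metric given by the strict gauge\<close>

lemma Metric_space_radial:
  "Metric_space (C::'a::linear_metric_space set) (\<lambda>x y. radial_gauge (y - x))"
proof
  fix x y z :: 'a
  show "0 \<le> radial_gauge (y - x)"
    by (rule radial_gauge_nonneg)
  show "radial_gauge (y - x) = radial_gauge (x - y)"
    using radial_gauge_minus[of "y - x"] by simp
  show "radial_gauge (y - x) = 0 \<longleftrightarrow> x = y"
    by (auto simp: radial_gauge_eq_0_iff)
  show "radial_gauge (z - x) \<le> radial_gauge (y - x) + radial_gauge (z - y)"
    using radial_gauge_add[of "y - x" "z - y"] by simp
qed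

text \<open>
  Continuity of the gauge at \<open>0\<close> makes its balls neighbourhoods; the lower bound
  \<open>radial_gauge_lower\<close> makes them small enough to fit into the original balls.
\<close>
lemma mtopology_radial_UNIV:
  "Metric_space.mtopology UNIV (\<lambda>x y::'a::linear_metric_space. radial_gauge (y - x)) = euclidean"
proof -
  interpret R: Metric_space "UNIV :: 'a set" "\<lambda>x y. radial_gauge (y - x)"
    by (rule Metric_space_radial)
  have "(\<exists>r>0. R.mball x r \<subseteq> U) \<longleftrightarrow> (\<exists>e>0. ball x e \<subseteq> U)" for x :: 'a and U
  proof
    assume "\<exists>r>0. R.mball x r \<subseteq> U"
    then obtain r where "r > 0" and r: "R.mball x r \<subseteq> U"
      by blast
    have "\<forall>\<^sub>F v in nhds (0::'a). radial_gauge v < r"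
      using order_tendstoD(2)[OF tendsto_radial_gauge \<open>r > 0\<close>] .
    then obtain e where "e > 0" and e: "\<And>v::'a. dist v 0 < e \<Longrightarrow> radial_gauge v < r"
      unfolding eventually_nhds_metric by blast
    have "ball x e \<subseteq> R.mball x r"
    proof
      fix y
      assume "y \<in> ball x e"
      then have "dist (y - x) 0 < e"
        using dist_eq_dist_0_diff[of y x] by (simp add: dist_commute)
      then show "y \<in> R.mball x r"
        using e by simp
    qed
    with r \<open>e > 0\<close> show "\<exists>e>0. ball x e \<subseteq> U"
      by blast
  next
    assume "\<exists>e>0. ball x e \<subseteq> U"
    then obtain e where "e > 0" and e: "ball x e \<subseteq> U"
      by blast
    obtain c where "c > 0" and c: "\<And>v::'a. c * min 1 (dist 0 v) \<le> radial_gauge v"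
      using radial_gauge_lower[where 'a='a] by blast
    have "R.mball x (c * min 1 e) \<subseteq> ball x e"
    proof
      fix y
      assume "y \<in> R.mball x (c * min 1 e)"
      then have "c * min 1 (dist 0 (y - x)) < c * min 1 e"
        using c[of "y - x"] by simp
      then have "min 1 (dist 0 (y - x)) < min 1 e"
        using \<open>c > 0\<close> by (simp only: mult_less_cancel_left_pos)
      then have "dist 0 (y - x) < e"
        by (auto simp: min_def split: if_splits)
      then show "y \<in> ball x e"
        using dist_eq_dist_0_diff[of y x] by (simp add: dist_commute)
    qed
    moreover have "0 < c * min 1 e"
      using \<open>c > 0\<close> \<open>e > 0\<close> by simp
    ultimately show "\<exists>r>0. R.mball x r \<subseteq> U"
      using e by blast
  qed
  then show ?thesis
    by (simp add: topology_eq R.openin_mtopology open_contains_ball Ball_def)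
qed

lemma mtopology_radial:
  "Metric_space.mtopology C (\<lambda>x y. radial_gauge (y - x)) = top_of_set (C::'a::linear_metric_space set)"
proof -
  interpret Submetric UNIV "\<lambda>x y. radial_gauge (y - x)" C
    by (intro Submetric.intro Metric_space_radial Submetric_axioms.intro) simp
  show ?thesis
    using mtopology_submetric by (simp only: mtopology_radial_UNIV)
qed

text \<open>
  A point at distance exactly \<open>r\<close> from the centre is approached along the segment that joins it to
  the centre; convexity keeps the segment inside \<open>C\<close>, strict growth keeps it inside the open ball.
\<close>
lemma round_metric_radial:
  fixes C :: "'a::linear_metric_space set"
  assumes "convex C"
  shows "round_metric C (\<lambda>x y. radial_gauge (y - x))"
proof -
  interpret R: Metric_space C "\<lambda>x y. radial_gauge (y - x)"
    by (rule Metric_space_radial)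
  have "z \<in> R.mtopology closure_of R.mball y r"
    if "y \<in> C" and "r > 0" and z: "z \<in> R.mcball y r" for y z r
    unfolding R.metric_closure_of
  proof (intro CollectI conjI allI impI)
    show "z \<in> C"
      using z by simp
    fix e :: real
    assume "e > 0"
    show "\<exists>w\<in>R.mball y r. w \<in> R.mball z e"
    proof (cases "z = y")
      case True
      then show ?thesis
        using that \<open>e > 0\<close> by blast
    next
      case False
      have "((\<lambda>s. s *\<^sub>R (y - z)) \<longlongrightarrow> 0 *\<^sub>R (y - z)) (at_right 0)"
        by (intro tendsto_scaleR_topological tendsto_const tendsto_ident_at)
      then have "((\<lambda>s. radial_gauge (s *\<^sub>R (y - z))) \<longlongrightarrow> 0) (at_right 0)"
        using filterlim_compose[OF tendsto_radial_gauge] by simp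
      then have "\<forall>\<^sub>F s in at_right 0. radial_gauge (s *\<^sub>R (y - z)) < e"
        using \<open>e > 0\<close> by (rule order_tendstoD)
      moreover have "\<forall>\<^sub>F s in at_right (0::real). s \<in> {0<..<1}"
        by (rule eventually_at_right_real) simp
      ultimately have "\<forall>\<^sub>F s in at_right 0. radial_gauge (s *\<^sub>R (y - z)) < e \<and> s \<in> {0<..<1}"
        by (rule eventually_conj)
      then obtain s where s: "radial_gauge (s *\<^sub>R (y - z)) < e" "0 < s" "s < 1"
        using eventually_happens[of _ "at_right (0::real)"] by (auto simp: trivial_limit_at_right_real)
      define w where "w = (1 - s) *\<^sub>R z + s *\<^sub>R y"
      have "w \<in> C"
        unfolding w_def using s that by (intro convexD[OF assms]) auto
      have "w - y = (1 - s) *\<^sub>R (z - y)" and "w - z = s *\<^sub>R (y - z)"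
        by (simp_all add: w_def algebra_simps)
      moreover have "radial_gauge ((1 - s) *\<^sub>R (z - y)) < radial_gauge (1 *\<^sub>R (z - y))"
        using s False by (intro radial_gauge_strict_mono) auto
      ultimately show ?thesis
        using s z that \<open>w \<in> C\<close> by (intro bexI[of _ w]) auto
    qed
  qed
  moreover have "R.mtopology closure_of R.mball y r \<subseteq> R.mcball y r" for y r
    by (intro closure_of_minimal R.mball_subset_mcball R.closedin_mcball)
  ultimately show ?thesis
    unfolding round_metric_def using R.Metric_space_axioms by blast
qed

theorem theorem3p5:
  fixes C :: "'a::linear_metric_space set"
  assumes "convex C"
    and "\<And>x. x \<in> C \<Longrightarrow> x \<noteq> 0 \<Longrightarrow> strict_mono_on {0..1} (\<lambda>t::real. dist 0 (t *\<^sub>R x))"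
  shows "round_space (top_of_set C)"
  unfolding round_space_def
  using round_metric_radial[OF assms(1)] mtopology_radial[of C] by auto

end
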